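(* Let $F$ be a field of characteristic not $2$ and let $R$ be a unital commutative associative $F$-algebra which is a unique factorization domain. Then $$\mathrm{Aut}_F(\mathfrak{sl}_2(R))=PGL_2(R)\rtimes \mathrm{Aut}_F(R),$$ that is, with $PGL_2(R)$ and $\mathrm{Aut}_F(R)$ regarded as subgroups of $\mathrm{Aut}_F(\mathfrak{sl}_2(R))$, the group $\mathrm{Aut}_F(\mathfrak{sl}_2(R))$ is the internal semidirect product of the normal subgroup $PGL_2(R)$ and the subgroup $\mathrm{Aut}_F(R)$.
   Context: $\mathfrak{sl}_2(R)$ denotes the set of $2\times 2$ matrices $\begin{pmatrix}a&b\\c&-a\end{pmatrix}$ with $a,b,c\in R$, viewed as a Lie algebra over $F$ under the commutator bracket; $\mathrm{Aut}_F(\mathfrak{sl}_2(R))$ is its group of $F$-Lie algebra automorphisms. $\mathrm{Aut}_F(R)$ is the group of $F$-algebra automorphisms of $R$; it is regarded as a subgroup of $\mathrm{Aut}_F(\mathfrak{sl}_2(R))$ by letting $\rho\in \mathrm{Aut}_F(R)$ act on each matrix entry. $GL_2(R)$ is the group of $2\times 2$ matrices over $R$ whose determinant is a unit of $R$; its center is $ZGL_2(R)=\{uI\mid u\in R^\times\}$, and $PGL_2(R)=GL_2(R)/ZGL_2(R)$. For $P\in GL_2(R)$ let $\tau_P$ be the automorphism $X\mapsto PXP^{-1}$ of $\mathfrak{sl}_2(R)$; the homomorphism $P\mapsto\tau_P$ has kernel $ZGL_2(R)$, and in this way $PGL_2(R)$ is regarded as a subgroup of $\mathrm{Aut}_F(\mathfrak{sl}_2(R))$.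 *)

theory Defs
  imports
    "HOL-Analysis.Determinants"
    "HOL-Algebra.Bij"
    "Berlekamp_Zassenhaus.Unique_Factorization"
begin

locale comm_algebra = vector_space scl
  for scl :: "'f::field \<Rightarrow> 'r::comm_ring_1 \<Rightarrow> 'r" +
  assumes scale_mult_left: "scl c (x * y) = scl c x * y"

definition sl2 :: "('r::comm_ring_1 ^ 2 ^ 2) set" where
  "sl2 = {X. X $ 2 $ 2 = - (X $ 1 $ 1)}"

definition lie_bracket :: "'r::comm_ring_1 ^ 2 ^ 2 \<Rightarrow> 'r ^ 2 ^ 2 \<Rightarrow> 'r ^ 2 ^ 2" where
  "lie_bracket X Y = X ** Y - Y ** X"

text \<open>
  Following \<^const>\<open>BijGroup\<close>, automorphisms are extensional functions on the carrier, so
  that two of them are equal as soon as they agree there.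
\<close>

definition Aut_sl2 ::
  "('f::field \<Rightarrow> 'r::comm_ring_1 \<Rightarrow> 'r) \<Rightarrow> ('r ^ 2 ^ 2 \<Rightarrow> 'r ^ 2 ^ 2) monoid" where
  "Aut_sl2 scl = BijGroup sl2 \<lparr>carrier := {f \<in> Bij sl2.
     (\<forall>X\<in>sl2. \<forall>Y\<in>sl2. f (X + Y) = f X + f Y) \<and>
     (\<forall>c. \<forall>X\<in>sl2. f (map_matrix (scl c) X) = map_matrix (scl c) (f X)) \<and>
     (\<forall>X\<in>sl2. \<forall>Y\<in>sl2. f (lie_bracket X Y) = lie_bracket (f X) (f Y))}\<rparr>"

definition Aut_alg :: "('f::field \<Rightarrow> 'r::comm_ring_1 \<Rightarrow> 'r) \<Rightarrow> ('r \<Rightarrow> 'r) monoid" where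
  "Aut_alg scl = BijGroup UNIV \<lparr>carrier := {\<rho> \<in> Bij UNIV.
     Vector_Spaces.linear scl scl \<rho> \<and> \<rho> 1 = 1 \<and> (\<forall>x y. \<rho> (x * y) = \<rho> x * \<rho> y)}\<rparr>"

definition entrywise :: "('r::comm_ring_1 \<Rightarrow> 'r) \<Rightarrow> 'r ^ 2 ^ 2 \<Rightarrow> 'r ^ 2 ^ 2" where
  "entrywise \<rho> = (\<lambda>X\<in>sl2. map_matrix \<rho> X)"

definition GL2 :: "('r::comm_ring_1 ^ 2 ^ 2) monoid" where
  "GL2 = \<lparr>carrier = {P. det P dvd 1}, mult = (**), one = mat 1\<rparr>"

definition ZGL2 :: "('r::comm_ring_1 ^ 2 ^ 2) set" where
  "ZGL2 = {mat u | u. u dvd 1}"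

definition PGL2 :: "('r::comm_ring_1 ^ 2 ^ 2) set monoid" where
  "PGL2 = GL2 Mod ZGL2"

definition conj_by :: "'r::comm_ring_1 ^ 2 ^ 2 \<Rightarrow> 'r ^ 2 ^ 2 \<Rightarrow> 'r ^ 2 ^ 2" where
  "conj_by P = (\<lambda>X\<in>sl2. P ** X ** matrix_inv P)"

text \<open>
  Elements of \<^const>\<open>PGL2\<close> are cosets of \<^const>\<open>ZGL2\<close>, on which \<^const>\<open>conj_by\<close> is
  constant; the following picks the common value, in the form used by the library's first
  isomorphism theorem for groups.
\<close>

definition PGL2_action :: "('r::comm_ring_1 ^ 2 ^ 2) set \<Rightarrow> 'r ^ 2 ^ 2 \<Rightarrow> 'r ^ 2 ^ 2" where
  "PGL2_action C = the_elem (conj_by ` C)"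

definition internal_semidirect_product ::
  "('a, 'm) monoid_scheme \<Rightarrow> 'a set \<Rightarrow> 'a set \<Rightarrow> bool" where
  "internal_semidirect_product G N H \<longleftrightarrow>
     N \<lhd> G \<and> subgroup H G \<and> N <#>\<^bsub>G\<^esub> H = carrier G \<and> N \<inter> H = {\<one>\<^bsub>G\<^esub>}"

end

theory Submission
  imports Defs
begin

text \<open>
  Write \<open>e\<close>, \<open>f\<close>, \<open>h = [e, f]\<close> for the standard basis of \<open>sl2\<close>. The images \<open>E\<close>, \<open>F\<close> of
  \<open>e\<close>, \<open>f\<close> under an automorphism \<open>g\<close> satisfy the same bracket relations, and the whole point is
  that such a pair is conjugate to \<open>e\<close>, \<open>f\<close> by a matrix with entries in \<open>R\<close> and unit determinant
  (\<open>sl2_triple_conjugate\<close>). As an eigenvector of \<open>ad [E, F]\<close> with eigenvalue \<open>2 \<noteq> 0\<close>, the matrix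
  \<open>E\<close> has determinant \<open>0\<close> (\<open>eigenvector_isotropic\<close>). Unique factorization then
  writes \<open>E\<close> as \<open>m\<close> times the matrix with rows \<open>(p r, p\<^sup>2)\<close> and \<open>(- r\<^sup>2, - p r)\<close>
  (\<open>isotropic_parametrization\<close>); this is the only place where factorization enters. The vector
  \<open>v = (p, - r)\<close> spans the kernel of \<open>E\<close> over the fraction field, and the matrix \<open>P\<close> with columns
  \<open>v\<close> and \<open>F v\<close> intertwines \<open>e\<close>, \<open>f\<close> with \<open>E\<close>, \<open>F\<close>. The relation \<open>[[E, F], E] = 2 E\<close> forces
  \<open>trace (E F) = 1\<close>, and this trace equals \<open>m * det P\<close>; so \<open>det P\<close> is a unit.

  After composing \<open>g\<close> with conjugation by the inverse of \<open>P\<close> it fixes \<open>e\<close> and \<open>f\<close>, and an automorphism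
  fixing them acts entrywise by an algebra automorphism of \<open>R\<close> (\<open>Aut_sl2_fixing_triple\<close>).
  This gives the product decomposition (\<open>Aut_sl2_decomposition\<close>). Normality holds because an
  entrywise automorphism \<open>\<rho>\<close> carries conjugation by \<open>P\<close> to conjugation by \<open>\<rho> P\<close>
  (\<open>entrywise_conj_by\<close>), and the two subgroups meet trivially because conjugations are
  \<open>R\<close>-linear. The embedding of \<open>PGL2\<close> comes from the first isomorphism theorem, since only
  scalar matrices commute with both \<open>e\<close> and \<open>f\<close> (\<open>kernel_conj_by\<close>).
\<close>

section \<open>Coordinates for two-by-two matrices\<close>

definition mat2 :: "'a::zero \<Rightarrow> 'a \<Rightarrow> 'a \<Rightarrow> 'a \<Rightarrow> 'a ^ 2 ^ 2" where
  "mat2 a b c d = (\<chi> i j. if i = 1 then (if j = 1 then a else b) else (if j = 1 then c else d))"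

lemma mat2_nth [simp]:
  "mat2 a b c d $ 1 $ 1 = a" "mat2 a b c d $ 1 $ 2 = b"
  "mat2 a b c d $ 2 $ 1 = c" "mat2 a b c d $ 2 $ 2 = d"
  by (simp_all add: mat2_def)

lemma mat2_eq_iff [simp]:
  "mat2 a b c d = mat2 a' b' c' d' \<longleftrightarrow> a = a' \<and> b = b' \<and> c = c' \<and> d = d'"
  by (auto simp: vec_eq_iff forall_2)

lemma mat2_cases: obtains a b c d where "X = mat2 a b c d"
proof
  show "X = mat2 (X $ 1 $ 1) (X $ 1 $ 2) (X $ 2 $ 1) (X $ 2 $ 2)"
    by (simp add: vec_eq_iff forall_2)
qed

lemma mat2_mult [simp]:
  fixes a :: "'a::semiring_1"
  shows "mat2 a b c d ** mat2 a' b' c' d' =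
    mat2 (a * a' + b * c') (a * b' + b * d') (c * a' + d * c') (c * b' + d * d')"
  by (simp add: vec_eq_iff forall_2 matrix_matrix_mult_def sum_2)

lemma mat2_add [simp]:
  fixes a :: "'a::monoid_add"
  shows "mat2 a b c d + mat2 a' b' c' d' = mat2 (a + a') (b + b') (c + c') (d + d')"
  by (simp add: vec_eq_iff forall_2)

lemma mat2_diff [simp]:
  fixes a :: "'a::group_add"
  shows "mat2 a b c d - mat2 a' b' c' d' = mat2 (a - a') (b - b') (c - c') (d - d')"
  by (simp add: vec_eq_iff forall_2)

lemma map_matrix_mat2 [simp]:
  "map_matrix f (mat2 a b c d) = mat2 (f a) (f b) (f c) (f d)"
  by (simp add: vec_eq_iff forall_2)

lemma mat_eq_mat2: "mat u = mat2 u 0 0 u"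
  by (simp add: vec_eq_iff forall_2 mat_def)

lemma det_mat2 [simp]: "det (mat2 a b c d) = a * d - b * c"
  by (simp add: det_2)

lemma mat2_in_sl2 [simp]: "mat2 a b c d \<in> sl2 \<longleftrightarrow> d = - a"
  by (simp add: sl2_def)

lemma sl2_cases:
  assumes "X \<in> sl2" obtains a b c where "X = mat2 a b c (- a)"
  using assms by (metis mat2_cases mat2_in_sl2)

lemma sl2_eq_trace: "X \<in> sl2 \<longleftrightarrow> trace X = 0"
  by (simp add: sl2_def trace_def sum_2 add_eq_0_iff)

lemma sl2_add: "X \<in> sl2 \<Longrightarrow> Y \<in> sl2 \<Longrightarrow> X + Y \<in> sl2"
  by (simp add: sl2_def)

lemma sl2_lie_bracket: "lie_bracket X Y \<in> sl2"
  by (simp add: sl2_eq_trace lie_bracket_def trace_sub trace_mul_sym[of Y X])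

lemma mat_mult_commute:
  fixes X :: "'r::comm_ring_1 ^ 2 ^ 2"
  shows "mat r ** X = X ** mat r"
  by (cases X rule: mat2_cases) (simp add: mat_eq_mat2 mult.commute)

lemma matrix_add_rdistrib:
  fixes A B :: "'a::semiring_1 ^ 'n ^ 'm"
  shows "(A + B) ** C = A ** C + B ** C"
  by (simp add: vec_eq_iff matrix_matrix_mult_def sum.distrib distrib_right)

lemma matrix_diff_ldistrib:
  fixes B C :: "'a::ring_1 ^ 'n ^ 'm"
  shows "A ** (B - C) = A ** B - A ** C"
  by (simp add: vec_eq_iff matrix_matrix_mult_def sum_subtractf right_diff_distrib)

lemma matrix_diff_rdistrib:
  fixes A B :: "'a::ring_1 ^ 'n ^ 'm"
  shows "(A - B) ** C = A ** C - B ** C"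
  by (simp add: vec_eq_iff matrix_matrix_mult_def sum_subtractf left_diff_distrib)

section \<open>Conjugation by invertible matrices\<close>

lemma GL2_inverse:
  fixes P :: "'r::comm_ring_1 ^ 2 ^ 2"
  assumes "det P dvd 1"
  shows "P ** matrix_inv P = mat 1" "matrix_inv P ** P = mat 1"
proof -
  obtain a b c d where P: "P = mat2 a b c d" by (rule mat2_cases)
  obtain u where u: "1 = (a * d - b * c) * u" using assms by (auto simp: P)
  \<comment> \<open>The adjugate of \<open>P\<close> divided by its determinant.\<close>
  let ?Q = "mat2 (u * d) (- u * b) (- u * c) (u * a)"
  have "P ** ?Q = mat 1 \<and> ?Q ** P = mat 1"
    using u by (simp add: P mat_eq_mat2) (simp add: algebra_simps)
  then have "P ** matrix_inv P = mat 1 \<and> matrix_inv P ** P = mat 1"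
    unfolding matrix_inv_def by (rule someI)
  then show "P ** matrix_inv P = mat 1" "matrix_inv P ** P = mat 1" by auto
qed

lemma det_unit_if_inverse: "P ** Q = mat 1 \<Longrightarrow> det P dvd 1"
  by (metis det_I det_mul dvdI)

lemma GL2_simps [simp]:
  "P \<in> carrier GL2 \<longleftrightarrow> det P dvd 1" "P \<otimes>\<^bsub>GL2\<^esub> Q = P ** Q" "\<one>\<^bsub>GL2\<^esub> = mat 1"
  by (simp_all add: GL2_def)

lemma det_matrix_inv_unit:
  fixes P :: "'r::comm_ring_1 ^ 2 ^ 2"
  shows "det P dvd 1 \<Longrightarrow> det (matrix_inv P) dvd 1"
  by (rule det_unit_if_inverse[OF GL2_inverse(2)])

lemma group_GL2: "group GL2"
proof (rule groupI)
  fix P Q :: "'a ^ 2 ^ 2"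
  assume "P \<in> carrier GL2" "Q \<in> carrier GL2"
  then show "P \<otimes>\<^bsub>GL2\<^esub> Q \<in> carrier GL2"
    using mult_dvd_mono[of "det P" 1 "det Q" 1] by (simp add: det_mul)
next
  fix P :: "'a ^ 2 ^ 2"
  assume "P \<in> carrier GL2"
  then show "\<exists>Q\<in>carrier GL2. Q \<otimes>\<^bsub>GL2\<^esub> P = \<one>\<^bsub>GL2\<^esub>"
    by (intro bexI[of _ "matrix_inv P"]) (simp_all add: GL2_inverse det_matrix_inv_unit)
qed (auto simp: matrix_mul_assoc)


text \<open>
  Replacing \<^const>\<open>matrix_inv\<close> by an intertwining equation turns each algebraic property of
  conjugation into a computation with products only.
\<close>

lemma conj_by_eq_iff:
  assumes "det P dvd 1" "X \<in> sl2"
  shows "conj_by P X = Y \<longleftrightarrow> P ** X = Y ** P"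
proof
  assume "conj_by P X = Y"
  then have "Y ** P = P ** X ** (matrix_inv P ** P)"
    using assms by (simp add: conj_by_def matrix_mul_assoc)
  then show "P ** X = Y ** P" using assms by (simp add: GL2_inverse)
next
  assume *: "P ** X = Y ** P"
  have "conj_by P X = Y ** (P ** matrix_inv P)"
    using assms * by (simp add: conj_by_def matrix_mul_assoc)
  then show "conj_by P X = Y" using assms by (simp add: GL2_inverse)
qed

lemma conj_by_in_sl2:
  assumes "det P dvd 1" "X \<in> sl2"
  shows "conj_by P X \<in> sl2"
proof -
  have "trace (conj_by P X) = trace (matrix_inv P ** (P ** X))"
    using assms by (simp add: conj_by_def trace_mul_sym[of "P ** X"])
  also have "\<dots> = trace X" using assms by (simp add: matrix_mul_assoc GL2_inverse)
  finally show ?thesis using assms by (simp add: sl2_eq_trace)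
qed

lemma conj_by_mult:
  assumes "det P dvd 1" "det Q dvd 1" "X \<in> sl2"
  shows "conj_by (P ** Q) X = conj_by P (conj_by Q X)"
proof -
  define Y where "Y = conj_by Q X"
  have Y: "Y \<in> sl2" "Q ** X = Y ** Q"
    using conj_by_eq_iff[OF assms(2,3), of Y] conj_by_in_sl2[OF assms(2,3)] by (auto simp: Y_def)
  define Z where "Z = conj_by P Y"
  have Z: "P ** Y = Z ** P" using conj_by_eq_iff[OF assms(1) Y(1), of Z] by (simp add: Z_def)
  have "det (P ** Q) dvd 1"
    using mult_dvd_mono[OF assms(1,2)] by (simp add: det_mul)
  moreover have "(P ** Q) ** X = Z ** (P ** Q)"
    by (metis Y(2) Z matrix_mul_assoc)
  ultimately show ?thesis
    using conj_by_eq_iff[of "P ** Q" X Z] assms by (simp add: Y_def Z_def)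
qed

lemma conj_by_mat:
  assumes "u dvd 1"
  shows "conj_by (mat u) = (\<lambda>X\<in>sl2. X)"
proof
  fix X :: "'a ^ 2 ^ 2"
  have "det (mat u :: 'a ^ 2 ^ 2) dvd 1"
    using mult_dvd_mono[OF assms assms] by (simp add: mat_eq_mat2)
  then show "conj_by (mat u) X = (\<lambda>X\<in>sl2. X) X"
    by (cases "X \<in> sl2") (simp add: conj_by_eq_iff mat_mult_commute, simp add: conj_by_def)
qed

lemma conj_by_inverse:
  assumes "det P dvd 1" "X \<in> sl2"
  shows "conj_by (matrix_inv P) (conj_by P X) = X" "conj_by P (conj_by (matrix_inv P) X) = X"
  using assms
  by (simp_all add: conj_by_mult[symmetric] det_matrix_inv_unit GL2_inverse conj_by_mat)

lemma conj_by_eq_id_imp_scalar: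
  assumes P: "det P dvd 1" and "conj_by P = (\<lambda>X\<in>sl2. X)"
  shows "P \<in> ZGL2"
proof -
  obtain a b c d where P_eq: "P = mat2 a b c d" by (rule mat2_cases)
  have comm: "P ** X = X ** P" if "X \<in> sl2" for X
    using conj_by_eq_iff[OF P that, of X] assms(2) that by simp
  \<comment> \<open>Commuting with \<open>e\<close> and with \<open>f\<close> is enough to be scalar.\<close>
  have "c = 0" "a = d" "b = 0"
    using comm[of "mat2 0 1 0 0"] comm[of "mat2 0 0 1 0"] by (auto simp: P_eq)
  then have "P = mat a" "a * a dvd 1" using P by (auto simp: P_eq mat_eq_mat2)
  then show ?thesis by (auto simp: ZGL2_def dest: dvd_mult_left)
qed

section \<open>The two automorphism groups\<close>

context comm_algebra
begin

lemma scl_eq_mult: "scl c x = scl c 1 * x"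
  using scale_mult_left[of c 1 x] by simp

text \<open>
  The action of \<open>F\<close> is multiplication by the scalar matrix of \<open>scl c 1\<close>, hence commutes with
  conjugation.
\<close>

lemma map_matrix_scl: "map_matrix (scl c) X = mat (scl c 1) ** X" for X :: "'r ^ 2 ^ 2"
proof (cases X rule: mat2_cases)
  case (1 p q r s)
  then show ?thesis
    using scl_eq_mult[of c p] scl_eq_mult[of c q] scl_eq_mult[of c r] scl_eq_mult[of c s]
    by (simp add: mat_eq_mat2)
qed

lemma map_matrix_scl_in_sl2: "X \<in> sl2 \<Longrightarrow> map_matrix (scl c) X \<in> sl2"
  by (simp add: sl2_def scale_minus_right)

lemma Aut_sl2_iff:
  "f \<in> carrier (Aut_sl2 scl) \<longleftrightarrow> f \<in> Bij sl2 \<and>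
     (\<forall>X\<in>sl2. \<forall>Y\<in>sl2. f (X + Y) = f X + f Y) \<and>
     (\<forall>c. \<forall>X\<in>sl2. f (map_matrix (scl c) X) = map_matrix (scl c) (f X)) \<and>
     (\<forall>X\<in>sl2. \<forall>Y\<in>sl2. f (lie_bracket X Y) = lie_bracket (f X) (f Y))"
  by (simp add: Aut_sl2_def)

lemma Aut_alg_iff:
  "\<rho> \<in> carrier (Aut_alg scl) \<longleftrightarrow> bij \<rho> \<and> \<rho> 1 = 1 \<and>
     (\<forall>x y. \<rho> (x + y) = \<rho> x + \<rho> y) \<and> (\<forall>c x. \<rho> (scl c x) = scl c (\<rho> x)) \<and>
     (\<forall>x y. \<rho> (x * y) = \<rho> x * \<rho> y)"
  using vector_space_axioms module_axioms
  by (auto simp: Aut_alg_def Bij_def Vector_Spaces.linear_def module_hom_def module_hom_axioms_def)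

lemma Aut_sl2D:
  assumes "f \<in> carrier (Aut_sl2 scl)"
  shows "f \<in> extensional sl2" "bij_betw f sl2 sl2"
    and "X \<in> sl2 \<Longrightarrow> f X \<in> sl2"
    and "X \<in> sl2 \<Longrightarrow> Y \<in> sl2 \<Longrightarrow> f (X + Y) = f X + f Y"
    and "X \<in> sl2 \<Longrightarrow> f (map_matrix (scl c) X) = map_matrix (scl c) (f X)"
    and "X \<in> sl2 \<Longrightarrow> Y \<in> sl2 \<Longrightarrow> f (lie_bracket X Y) = lie_bracket (f X) (f Y)"
  using assms by (auto simp: Aut_sl2_iff Bij_def bij_betw_def)

lemma subgroup_Aut_sl2: "subgroup (carrier (Aut_sl2 scl)) (BijGroup sl2)"
proof (rule subgroup.intro)
  show "carrier (Aut_sl2 scl) \<subseteq> carrier (BijGroup sl2)"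
    by (auto simp: Aut_sl2_iff BijGroup_def)
next
  fix f g assume f: "f \<in> carrier (Aut_sl2 scl)" and g: "g \<in> carrier (Aut_sl2 scl)"
  then have "compose sl2 f g \<in> Bij sl2" by (auto simp: Aut_sl2_iff intro: compose_Bij)
  then show "f \<otimes>\<^bsub>BijGroup sl2\<^esub> g \<in> carrier (Aut_sl2 scl)"
    using f g
    by (auto simp: BijGroup_def Aut_sl2_iff compose_def sl2_add sl2_lie_bracket
        map_matrix_scl_in_sl2 Aut_sl2D(3-6)[OF f] Aut_sl2D(3-6)[OF g])
next
  show "\<one>\<^bsub>BijGroup sl2\<^esub> \<in> carrier (Aut_sl2 scl)"
    by (simp add: BijGroup_def Aut_sl2_iff id_Bij sl2_add sl2_lie_bracket map_matrix_scl_in_sl2)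
next
  fix f assume f: "f \<in> carrier (Aut_sl2 scl)"
  then have Bij: "f \<in> Bij sl2" by (simp add: Aut_sl2_iff)
  note inv_compat = Bij_inv_into_lemma[OF _ Bij]
  have "inv_into sl2 f (X + Y) = inv_into sl2 f X + inv_into sl2 f Y"
    if "X \<in> sl2" "Y \<in> sl2" for X Y
    by (rule inv_compat) (use that f in \<open>auto simp: Aut_sl2D sl2_add\<close>)
  moreover have "inv_into sl2 f (lie_bracket X Y) = lie_bracket (inv_into sl2 f X) (inv_into sl2 f Y)"
    if "X \<in> sl2" "Y \<in> sl2" for X Y
    by (rule inv_compat) (use that f in \<open>auto simp: Aut_sl2D sl2_lie_bracket\<close>)
  moreover have "inv_into sl2 f (map_matrix (scl c) X) = map_matrix (scl c) (inv_into sl2 f X)"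
    if "X \<in> sl2" for c X
    \<comment> \<open>A unary operation is treated as a binary one that ignores its first argument.\<close>
    by (rule inv_compat[where g = "\<lambda>_. map_matrix (scl c)" and x = X])
      (use that f in \<open>auto simp: Aut_sl2D map_matrix_scl_in_sl2\<close>)
  ultimately show "inv\<^bsub>BijGroup sl2\<^esub> f \<in> carrier (Aut_sl2 scl)"
    using restrict_inv_into_Bij[OF Bij]
    by (simp add: inv_BijGroup[OF Bij] Aut_sl2_iff sl2_add sl2_lie_bracket map_matrix_scl_in_sl2)
qed

lemma group_Aut_sl2: "group (Aut_sl2 scl)"
  using subgroup.subgroup_is_group[OF subgroup_Aut_sl2 group_BijGroup]
  by (simp add: Aut_sl2_def)

lemma Aut_sl2_mult:
  assumes "f \<in> carrier (Aut_sl2 scl)" "g \<in> carrier (Aut_sl2 scl)"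
  shows "f \<otimes>\<^bsub>Aut_sl2 scl\<^esub> g = (\<lambda>X\<in>sl2. f (g X))"
  using assms by (auto simp: Aut_sl2_def BijGroup_def compose_def)

lemma Aut_sl2_one: "\<one>\<^bsub>Aut_sl2 scl\<^esub> = (\<lambda>X\<in>sl2. X)"
  by (simp add: Aut_sl2_def BijGroup_def)

lemma subgroup_Aut_alg: "subgroup (carrier (Aut_alg scl)) (BijGroup UNIV)"
proof (rule subgroup.intro)
  show "carrier (Aut_alg scl) \<subseteq> carrier (BijGroup UNIV)"
    by (auto simp: Aut_alg_iff BijGroup_def Bij_def)
next
  fix f g assume "f \<in> carrier (Aut_alg scl)" "g \<in> carrier (Aut_alg scl)"
  then show "f \<otimes>\<^bsub>BijGroup UNIV\<^esub> g \<in> carrier (Aut_alg scl)"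
    by (auto simp: BijGroup_def Bij_def Aut_alg_iff compose_def bij_comp[unfolded comp_def])
next
  show "\<one>\<^bsub>BijGroup UNIV\<^esub> \<in> carrier (Aut_alg scl)"
    by (simp add: BijGroup_def Aut_alg_iff bij_id[unfolded id_def])
next
  fix f assume f: "f \<in> carrier (Aut_alg scl)"
  then have Bij: "f \<in> Bij UNIV" and bij: "bij f" by (auto simp: Bij_def Aut_alg_iff)
  note inv_compat = Bij_inv_into_lemma[OF _ Bij]
  have "inv_into UNIV f (x + y) = inv_into UNIV f x + inv_into UNIV f y" for x y
    by (rule inv_compat) (use f in \<open>auto simp: Aut_alg_iff\<close>)
  moreover have "inv_into UNIV f (x * y) = inv_into UNIV f x * inv_into UNIV f y" for x y
    by (rule inv_compat) (use f in \<open>auto simp: Aut_alg_iff\<close>)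
  moreover have "inv_into UNIV f (scl c x) = scl c (inv_into UNIV f x)" for c x
    by (rule inv_compat[where g = "\<lambda>_. scl c" and x = x]) (use f in \<open>auto simp: Aut_alg_iff\<close>)
  moreover have "inv_into UNIV f 1 = 1"
    using f bij by (metis Aut_alg_iff bij_inv_eq_iff)
  ultimately show "inv\<^bsub>BijGroup UNIV\<^esub> f \<in> carrier (Aut_alg scl)"
    using bij by (simp add: inv_BijGroup[OF Bij] Aut_alg_iff bij_imp_bij_inv)
qed

lemma group_Aut_alg: "group (Aut_alg scl)"
  using subgroup.subgroup_is_group[OF subgroup_Aut_alg group_BijGroup]
  by (simp add: Aut_alg_def)

lemma Aut_alg_mult:
  assumes "f \<in> carrier (Aut_alg scl)" "g \<in> carrier (Aut_alg scl)"
  shows "f \<otimes>\<^bsub>Aut_alg scl\<^esub> g = (\<lambda>x. f (g x))"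
  using assms by (auto simp: Aut_alg_def BijGroup_def compose_def)

section \<open>The embeddings of the projective linear group and of the algebra automorphisms\<close>

lemma conj_by_in_Aut_sl2:
  assumes P: "det P dvd 1"
  shows "conj_by P \<in> carrier (Aut_sl2 scl)"
proof -
  have ext: "conj_by P \<in> extensional sl2" by (simp add: conj_by_def)
  have bij: "bij_betw (conj_by P) sl2 sl2"
    by (rule bij_betw_byWitness[where f' = "conj_by (matrix_inv P)"])
      (use P in \<open>auto simp: conj_by_inverse conj_by_in_sl2 det_matrix_inv_unit\<close>)
  have intertwines: "P ** X = conj_by P X ** P" if "X \<in> sl2" for X
    using conj_by_eq_iff[OF P that] by blast
  have "conj_by P (X + Y) = conj_by P X + conj_by P Y" if "X \<in> sl2" "Y \<in> sl2" for X Y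
    using that intertwines
    by (simp add: conj_by_eq_iff P sl2_add matrix_add_ldistrib matrix_add_rdistrib)
  moreover have "conj_by P (lie_bracket X Y) = lie_bracket (conj_by P X) (conj_by P Y)"
    if "X \<in> sl2" "Y \<in> sl2" for X Y
  proof -
    have "P ** (X ** Y) = conj_by P X ** conj_by P Y ** P"
      "P ** (Y ** X) = conj_by P Y ** conj_by P X ** P"
      using that intertwines by (metis matrix_mul_assoc)+
    then show ?thesis
      unfolding conj_by_eq_iff[OF P sl2_lie_bracket]
      by (simp add: lie_bracket_def matrix_diff_ldistrib matrix_diff_rdistrib)
  qed
  moreover have "conj_by P (map_matrix (scl c) X) = map_matrix (scl c) (conj_by P X)"
    if "X \<in> sl2" for c X
  proof -
    have "P ** (mat (scl c 1) ** X) = mat (scl c 1) ** conj_by P X ** P"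
      by (metis intertwines[OF that] mat_mult_commute matrix_mul_assoc)
    then show ?thesis
      using that by (simp add: conj_by_eq_iff P map_matrix_scl_in_sl2) (simp add: map_matrix_scl)
  qed
  ultimately show ?thesis using ext bij by (simp add: Aut_sl2_iff Bij_def)
qed

lemma group_hom_conj_by: "group_hom GL2 (Aut_sl2 scl) conj_by"
proof (intro group_hom.intro group_GL2 group_Aut_sl2 group_hom_axioms.intro homI)
  fix P Q :: "'r ^ 2 ^ 2" assume "P \<in> carrier GL2" "Q \<in> carrier GL2"
  then have PQ: "det P dvd 1" "det Q dvd 1" by auto
  show "conj_by (P \<otimes>\<^bsub>GL2\<^esub> Q) = conj_by P \<otimes>\<^bsub>Aut_sl2 scl\<^esub> conj_by Q"
    by (rule extensionalityI[where A = sl2])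
      (use PQ in \<open>simp_all add: Aut_sl2_mult conj_by_in_Aut_sl2 conj_by_mult, simp add: conj_by_def\<close>)
qed (auto simp: conj_by_in_Aut_sl2)

lemma kernel_conj_by: "kernel GL2 (Aut_sl2 scl) conj_by = ZGL2"
proof (intro equalityI subsetI)
  fix P assume "P \<in> kernel GL2 (Aut_sl2 scl) conj_by"
  then show "P \<in> ZGL2"
    by (intro conj_by_eq_id_imp_scalar) (auto simp: kernel_def Aut_sl2_one)
next
  fix P :: "'r ^ 2 ^ 2" assume "P \<in> ZGL2"
  then obtain u where u: "P = mat u" "u dvd 1" by (auto simp: ZGL2_def)
  have "det P dvd 1" using mult_dvd_mono[OF u(2) u(2)] by (simp add: u(1) mat_eq_mat2)
  then show "P \<in> kernel GL2 (Aut_sl2 scl) conj_by"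
    using u by (simp add: kernel_def Aut_sl2_one conj_by_mat)
qed

lemma PGL2_action_mon: "PGL2_action \<in> mon PGL2 (Aut_sl2 scl)"
proof -
  interpret group_hom GL2 "Aut_sl2 scl" conj_by by (rule group_hom_conj_by)
  show ?thesis
    using FactGroup_hom FactGroup_inj_on
    by (simp add: mon_def PGL2_def kernel_conj_by PGL2_action_def[abs_def])
qed

lemma PGL2_action_image:
  "PGL2_action ` carrier PGL2 = conj_by ` (carrier GL2 :: ('r ^ 2 ^ 2) set)"
proof -
  interpret group_hom GL2 "Aut_sl2 scl" conj_by by (rule group_hom_conj_by)
  have "PGL2_action (ZGL2 #>\<^bsub>GL2\<^esub> P) = conj_by P"
    if "P \<in> carrier GL2" for P :: "'r ^ 2 ^ 2"
  proof -
    have "conj_by (Q ** P) = conj_by P" if "Q \<in> ZGL2" for Q :: "'r ^ 2 ^ 2"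
      using that \<open>P \<in> carrier GL2\<close> hom_mult[of Q P] H.l_one[of "conj_by P"]
      by (simp add: kernel_conj_by[symmetric] kernel_def conj_by_in_Aut_sl2)
    moreover have "mat 1 \<in> ZGL2" by (auto simp: ZGL2_def)
    ultimately have "conj_by ` (\<lambda>Q. Q ** P) ` ZGL2 = {conj_by P}" by force
    then have "conj_by ` (ZGL2 #>\<^bsub>GL2\<^esub> P) = {conj_by P}"
      by (simp add: r_coset_def UNION_singleton_eq_range)
    then show ?thesis by (simp add: PGL2_action_def)
  qed
  moreover have "PGL2_action ` carrier PGL2 = (\<lambda>P. PGL2_action (ZGL2 #>\<^bsub>GL2\<^esub> P)) ` carrier GL2"
    by (simp only: PGL2_def carrier_FactGroup image_image)
  ultimately show ?thesis by (metis (no_types, lifting) image_cong)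
qed

lemma Aut_alg_simps:
  assumes "\<rho> \<in> carrier (Aut_alg scl)"
  shows "\<rho> 0 = 0" "\<rho> 1 = 1" "\<rho> (x + y) = \<rho> x + \<rho> y" "\<rho> (- x) = - \<rho> x" "\<rho> (x - y) = \<rho> x - \<rho> y"
    "\<rho> (x * y) = \<rho> x * \<rho> y" "\<rho> (scl c x) = scl c (\<rho> x)"
proof -
  have add: "\<rho> (x + y) = \<rho> x + \<rho> y" for x y using assms by (simp add: Aut_alg_iff)
  then interpret additive \<rho> by unfold_locales
  show "\<rho> 0 = 0" "\<rho> 1 = 1" "\<rho> (x + y) = \<rho> x + \<rho> y" "\<rho> (- x) = - \<rho> x" "\<rho> (x - y) = \<rho> x - \<rho> y"
    "\<rho> (x * y) = \<rho> x * \<rho> y" "\<rho> (scl c x) = scl c (\<rho> x)"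
    using assms by (auto simp: zero minus diff add Aut_alg_iff)
qed

lemma map_matrix_Aut_alg_mult:
  fixes X Y :: "'r ^ 2 ^ 2"
  assumes "\<rho> \<in> carrier (Aut_alg scl)"
  shows "map_matrix \<rho> (X ** Y) = map_matrix \<rho> X ** map_matrix \<rho> Y"
  by (cases X rule: mat2_cases, cases Y rule: mat2_cases) (simp add: Aut_alg_simps[OF assms])

lemma det_map_matrix_Aut_alg:
  assumes "\<rho> \<in> carrier (Aut_alg scl)"
  shows "det (map_matrix \<rho> P) = \<rho> (det (P :: 'r ^ 2 ^ 2))"
  by (simp add: det_2 Aut_alg_simps[OF assms])

lemma entrywise_in_Aut_sl2:
  assumes \<rho>: "\<rho> \<in> carrier (Aut_alg scl)"
  shows "entrywise \<rho> \<in> carrier (Aut_sl2 scl)"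
proof -
  note simps = Aut_alg_simps[OF \<rho>]
  have bij: "bij \<rho>" using \<rho> by (simp add: Aut_alg_iff)
  have "inj_on (map_matrix \<rho>) sl2"
    using bij by (auto simp: inj_on_def vec_eq_iff bij_def)
  moreover have "map_matrix \<rho> ` sl2 = sl2"
  proof (intro equalityI subsetI)
    fix X :: "'r ^ 2 ^ 2" assume "X \<in> sl2"
    then obtain a b c where X: "X = mat2 a b c (- a)" by (rule sl2_cases)
    obtain a' b' c' where "a = \<rho> a'" "b = \<rho> b'" "c = \<rho> c'" using bij by (metis bij_pointE)
    then have "X = map_matrix \<rho> (mat2 a' b' c' (- a'))" by (simp add: X simps)
    then show "X \<in> map_matrix \<rho> ` sl2" by (rule image_eqI) simp
  qed (auto simp: sl2_def simps)
  ultimately have "entrywise \<rho> \<in> Bij sl2"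
    unfolding entrywise_def Bij_def by (simp add: bij_betw_def inj_on_restrict_eq)
  moreover have "map_matrix \<rho> (lie_bracket X Y) = lie_bracket (map_matrix \<rho> X) (map_matrix \<rho> Y)"
    for X Y :: "'r ^ 2 ^ 2"
    by (cases X rule: mat2_cases, cases Y rule: mat2_cases) (simp add: lie_bracket_def simps)
  ultimately show ?thesis
    by (simp add: Aut_sl2_iff entrywise_def sl2_add sl2_lie_bracket map_matrix_scl_in_sl2)
      (simp add: vec_eq_iff simps)
qed

lemma group_hom_entrywise: "group_hom (Aut_alg scl) (Aut_sl2 scl) entrywise"
proof (intro group_hom.intro group_Aut_alg group_Aut_sl2 group_hom_axioms.intro homI)
  fix \<rho> \<sigma> assume \<rho>: "\<rho> \<in> carrier (Aut_alg scl)" and \<sigma>: "\<sigma> \<in> carrier (Aut_alg scl)"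
  have "map_matrix \<sigma> X \<in> sl2" if "X \<in> sl2" for X
    using that by (simp add: sl2_def Aut_alg_simps[OF \<sigma>])
  then show "entrywise (\<rho> \<otimes>\<^bsub>Aut_alg scl\<^esub> \<sigma>) = entrywise \<rho> \<otimes>\<^bsub>Aut_sl2 scl\<^esub> entrywise \<sigma>"
    unfolding Aut_alg_mult[OF \<rho> \<sigma>] Aut_sl2_mult[OF entrywise_in_Aut_sl2[OF \<rho>] entrywise_in_Aut_sl2[OF \<sigma>]]
    by (auto simp: entrywise_def vec_eq_iff intro!: restrict_ext)
qed (rule entrywise_in_Aut_sl2)

lemma entrywise_inj: "inj_on entrywise (carrier (Aut_alg scl))"
proof (rule inj_onI)
  fix \<rho> \<sigma> :: "'r \<Rightarrow> 'r" assume eq: "entrywise \<rho> = entrywise \<sigma>"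
  show "\<rho> = \<sigma>"
  proof
    fix x
    show "\<rho> x = \<sigma> x" using fun_cong[OF eq, of "mat2 0 x 0 0"] by (simp add: entrywise_def)
  qed
qed

lemma det_map_matrix_Aut_alg_unit:
  fixes P :: "'r ^ 2 ^ 2"
  assumes \<rho>: "\<rho> \<in> carrier (Aut_alg scl)" and P: "det P dvd 1"
  shows "det (map_matrix \<rho> P) dvd 1"
proof -
  obtain u where "1 = det P * u" using P by (rule dvdE)
  then have "1 = \<rho> (det P) * \<rho> u" by (metis Aut_alg_simps(2,6)[OF \<rho>])
  then show ?thesis by (metis det_map_matrix_Aut_alg[OF \<rho>] dvdI)
qed

text \<open>
  The commutation rule between the two factors: it makes the group of conjugations stable under
  the algebra automorphisms, which is what normality needs beyond the product decomposition.
\<close>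

lemma entrywise_conj_by:
  assumes \<rho>: "\<rho> \<in> carrier (Aut_alg scl)" and P: "det P dvd 1" and X: "X \<in> sl2"
  shows "entrywise \<rho> (conj_by P X) = conj_by (map_matrix \<rho> P) (entrywise \<rho> X)"
proof -
  have det: "det (map_matrix \<rho> P) dvd 1" using \<rho> P by (rule det_map_matrix_Aut_alg_unit)
  have "P ** X = conj_by P X ** P" using conj_by_eq_iff[OF P X] by blast
  then have "map_matrix \<rho> P ** map_matrix \<rho> X = map_matrix \<rho> (conj_by P X) ** map_matrix \<rho> P"
    by (metis map_matrix_Aut_alg_mult[OF \<rho>])
  then show "entrywise \<rho> (conj_by P X) = conj_by (map_matrix \<rho> P) (entrywise \<rho> X)"
    using X det P Aut_sl2D(3)[OF entrywise_in_Aut_sl2[OF \<rho>] X]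
    by (subst eq_commute) (simp add: conj_by_eq_iff entrywise_def conj_by_in_sl2)
qed

end

section \<open>Conjugacy of the standard triple over a unique factorization domain\<close>

lemma coprime_factorization:
  fixes a b :: "'r::ufd"
  assumes "b \<noteq> 0"
  obtains g a' b' where "a = g * a'" "b = g * b'" "Unique_Factorization.coprime a' b'"
proof -
  let ?g = "some_gcd a b"
  obtain a' b' where ab: "a = ?g * a'" "b = ?g * b'"
    using some_gcd.gcd_dvd1[of a b] some_gcd.gcd_dvd2[of a b] unfolding dvd_def by blast
  have g: "?g \<noteq> 0" using ab assms by auto
  have "x dvd 1" if "x dvd a'" "x dvd b'" for x
  proof -
    have "?g * x dvd ?g"
      using that ab some_gcd.gcd_greatest[of "?g * x" a b] by (metis dvd_refl mult_dvd_mono)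
    then show ?thesis using g by (metis dvd_times_left_cancel_iff mult.right_neutral)
  qed
  then show ?thesis using that ab Unique_Factorization.coprimeI by blast
qed

text \<open>
  The equation says that the matrix with rows \<open>(a, b)\<close> and \<open>(c, - a)\<close> squares to zero. Cancelling a
  greatest common divisor \<open>g\<close> of \<open>a = g r\<close> and \<open>b = g p\<close> leaves \<open>g r\<^sup>2 = - c p\<close>. As \<open>p\<close> is coprime
  to \<open>r\<close>, it divides \<open>g\<close>, and the quotient is \<open>m\<close>.
\<close>

lemma isotropic_parametrization:
  fixes a b c :: "'r::ufd"
  assumes "a * a + b * c = 0"
  obtains m p r where "a = m * (p * r)" "b = m * (p * p)" "c = - (m * (r * r))"
proof (cases "b = 0")
  case True
  \<comment> \<open>Then also \<open>a = 0\<close>, and a common divisor of \<open>a\<close> and \<open>b\<close> says nothing about \<open>c\<close>.\<close>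
  then show ?thesis using assms that[of "- c" 0 1] by auto
next
  case False
  then obtain g r p where ab: "a = g * r" "b = g * p" and cop: "Unique_Factorization.coprime r p"
    using coprime_factorization by blast
  have "g \<noteq> 0" "p \<noteq> 0" using False ab by auto
  have "g * (g * (r * r)) = g * (- c * p)"
    using assms by (simp add: ab algebra_simps add_eq_0_iff)
  then have eq: "(g * r) * r = - c * p" using \<open>g \<noteq> 0\<close> by (simp only: mult_cancel_left mult.assoc) simp
  have "p dvd g * r" using some_gcd.coprime_mult_cross_dvd(2)[OF cop eq] .
  then obtain k where "g * r = k * p" by (metis dvdE mult.commute)
  from some_gcd.coprime_mult_cross_dvd(2)[OF cop this] obtain m where m: "g = p * m" by (rule dvdE)
  have "p * (m * (r * r)) = p * (- c)" using eq by (simp add: m algebra_simps)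
  then have "c = - (m * (r * r))" using \<open>p \<noteq> 0\<close> by (metis mult_left_cancel minus_minus)
  then show ?thesis using that[of m p r] by (simp add: ab m algebra_simps)
qed

text \<open>
  With \<open>E\<close> the eigenvector, \<open>2 * trace (E E) = trace ([H, E] E) = 0\<close> because the trace is
  invariant under cyclic permutation, and \<open>trace (E E) = 2 (a\<^sup>2 + b c)\<close>.
\<close>

lemma eigenvector_isotropic:
  fixes a b c :: "'r::idom"
  assumes two: "(2::'r) \<noteq> 0" and "H \<in> sl2"
    and "lie_bracket H (mat2 a b c (- a)) = mat2 a b c (- a) + mat2 a b c (- a)"
  shows "a * a + b * c = 0"
proof -
  obtain x y z where H: "H = mat2 x y z (- x)" using assms(2) by (rule sl2_cases)
  have "x * a + y * c - (a * x + b * z) = a + a" "x * b + y * - a - (a * y + b * - x) = b + b"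
    "z * a + - x * c - (c * x + - a * z) = c + c"
    using assms(3)
    unfolding H lie_bracket_def mat2_mult mat2_diff mat2_add mat2_eq_iff by blast+
  then have "2 * (2 * (a * a + b * c)) = 0" by algebra
  then show ?thesis using two by (simp only: mult_eq_0_iff) simp
qed

text \<open>
  Let \<open>v = (p, - r)\<close>, so that \<open>E v = 0\<close>, and let \<open>P\<close> have the columns \<open>v\<close> and \<open>F v\<close>. Then
  \<open>P f = F P\<close> amounts to \<open>F (F v) = 0\<close>, which holds because \<open>F\<close> squares to zero, and \<open>P e = E P\<close>
  amounts to \<open>E (F v) = v\<close>. Since \<open>E (F v) = (m * det P) v\<close>, both this and
  the invertibility of \<open>P\<close> come down to \<open>m * det P = 1\<close>.
\<close>

lemma sl2_triple_conjugate:
  fixes E F :: "'r::ufd ^ 2 ^ 2"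
  assumes two: "(2::'r) \<noteq> 0" and "E \<in> sl2" "F \<in> sl2" "E \<noteq> 0"
    and brE: "lie_bracket (lie_bracket E F) E = E + E"
    and brF: "lie_bracket (lie_bracket F E) F = F + F"
  obtains P where "det P dvd 1" "P ** mat2 0 1 0 0 = E ** P" "P ** mat2 0 0 1 0 = F ** P"
proof -
  obtain a b c where E: "E = mat2 a b c (- a)" using assms(2) by (rule sl2_cases)
  obtain x y z where F: "F = mat2 x y z (- x)" using assms(3) by (rule sl2_cases)
  have abc: "a * a + b * c = 0" and xyz: "x * x + y * z = 0"
    using brE brF eigenvector_isotropic[OF two sl2_lie_bracket] by (auto simp: E F)
  \<comment> \<open>\<open>t\<close> is the trace of \<open>E F\<close>. As \<open>E\<close> squares to zero, the relation for \<open>E\<close> reads \<open>2 E F E = 2 E\<close>,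
      while \<open>E F E = t E\<close> since \<open>E\<close> has rank one.\<close>
  define t where "t = 2 * a * x + b * z + c * y"
  have "2 * (b * (t - 1)) = 0" "2 * (c * (t - 1)) = 0"
    using brE abc unfolding t_def E F by (simp_all add: lie_bracket_def) algebra+
  then have "b = 0 \<and> c = 0 \<or> t = 1" using two by auto
  moreover have "\<not> (b = 0 \<and> c = 0)"
  proof
    assume *: "b = 0 \<and> c = 0"
    then have "a = 0" using abc by simp
    then show False using * \<open>E \<noteq> 0\<close> by (simp add: E vec_eq_iff forall_2)
  qed
  ultimately have t: "t = 1" by blast
  obtain m p r where mpr: "a = m * (p * r)" "b = m * (p * p)" "c = - (m * (r * r))"
    using isotropic_parametrization[OF abc] by blast
  define P where "P = mat2 p (x * p - y * r) (- r) (z * p + x * r)"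
  have "m * det P = 1"
    using t unfolding t_def P_def mpr by (simp add: algebra_simps)
  then have "det P dvd 1" by (metis dvd_triv_right)
  moreover have "P ** mat2 0 1 0 0 = E ** P"
    using t unfolding t_def P_def E mpr by simp algebra
  moreover have "P ** mat2 0 0 1 0 = F ** P"
    using xyz unfolding P_def F by simp algebra
  ultimately show ?thesis by (rule that)
qed

section \<open>Automorphisms fixing the standard triple\<close>

text \<open>
  An automorphism fixing \<open>e\<close> and \<open>f\<close> also fixes \<open>h = [e, f]\<close>, so it preserves the eigenspaces
  \<open>R e\<close>, \<open>R f\<close> of \<open>ad h\<close>; this yields additive maps \<open>\<alpha>\<close>, \<open>\<beta>\<close> on \<open>R\<close>. Applying it to
  \<open>[r e, s f] = r s h\<close> shows that the action on \<open>R h\<close> is \<open>r s \<mapsto> \<alpha> r * \<beta> s\<close>. Putting \<open>s = 1\<close> or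
  \<open>r = 1\<close> gives \<open>\<alpha> = \<beta>\<close>, and then the same formula says that \<open>\<alpha>\<close> is multiplicative.
\<close>

lemma (in comm_algebra) Aut_sl2_fixing_triple:
  assumes two: "\<And>x::'r. x + x = 0 \<Longrightarrow> x = 0"
    and g: "g \<in> carrier (Aut_sl2 scl)"
    and ge: "g (mat2 0 1 0 0) = mat2 0 1 0 0" and gf: "g (mat2 0 0 1 0) = mat2 0 0 1 0"
  obtains \<rho> where "\<rho> \<in> carrier (Aut_alg scl)" "g = entrywise \<rho>"
proof -
  note g_sl2 = Aut_sl2D(3)[OF g] and g_add = Aut_sl2D(4)[OF g] and g_scl = Aut_sl2D(5)[OF g]
    and g_br = Aut_sl2D(6)[OF g]
  let ?h = "mat2 1 0 0 (- 1) :: 'r ^ 2 ^ 2"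
  have gh: "g ?h = ?h"
    using g_br[of "mat2 0 1 0 0" "mat2 0 0 1 0"] by (simp add: lie_bracket_def ge gf)
  define \<alpha> where "\<alpha> r = g (mat2 0 r 0 0) $ 1 $ 2" for r
  define \<beta> where "\<beta> r = g (mat2 0 0 r 0) $ 2 $ 1" for r
  have ge_eq: "g (mat2 0 r 0 0) = mat2 0 (\<alpha> r) 0 0" for r
  proof -
    have "g (mat2 0 r 0 0) \<in> sl2" by (rule g_sl2) simp
    then obtain x y z where X: "g (mat2 0 r 0 0) = mat2 x y z (- x)" by (rule sl2_cases)
    have "lie_bracket ?h (mat2 0 r 0 0) = mat2 0 r 0 0 + mat2 0 r 0 0" by (simp add: lie_bracket_def)
    then have "lie_bracket ?h (mat2 x y z (- x)) = mat2 x y z (- x) + mat2 x y z (- x)"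
      using g_br[of ?h "mat2 0 r 0 0"] g_add[of "mat2 0 r 0 0" "mat2 0 r 0 0"] by (simp add: X gh)
    then have "x + x = 0" "(z + z) + (z + z) = 0" by (auto simp: lie_bracket_def algebra_simps)
    then have "x = 0" "z = 0" using two by blast+
    then show ?thesis by (simp add: \<alpha>_def X)
  qed
  have gf_eq: "g (mat2 0 0 r 0) = mat2 0 0 (\<beta> r) 0" for r
  proof -
    have "g (mat2 0 0 r 0) \<in> sl2" by (rule g_sl2) simp
    then obtain x y z where X: "g (mat2 0 0 r 0) = mat2 x y z (- x)" by (rule sl2_cases)
    have "lie_bracket (mat2 0 0 r 0) ?h = mat2 0 0 r 0 + mat2 0 0 r 0" by (simp add: lie_bracket_def)
    then have "lie_bracket (mat2 x y z (- x)) ?h = mat2 x y z (- x) + mat2 x y z (- x)"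
      using g_br[of "mat2 0 0 r 0" ?h] g_add[of "mat2 0 0 r 0" "mat2 0 0 r 0"] by (simp add: X gh)
    then have "x + x = 0" "(y + y) + (y + y) = 0" by (auto simp: lie_bracket_def algebra_simps)
    then have "x = 0" "y = 0" using two by blast+
    then show ?thesis by (simp add: \<beta>_def X)
  qed
  have gh_eq: "g (mat2 (r * s) 0 0 (- (r * s))) = mat2 (\<alpha> r * \<beta> s) 0 0 (- (\<alpha> r * \<beta> s))" for r s
    using g_br[of "mat2 0 r 0 0" "mat2 0 0 s 0"] by (simp add: lie_bracket_def ge_eq gf_eq mult.commute)
  have one: "\<alpha> 1 = 1" "\<beta> 1 = 1" by (simp_all add: \<alpha>_def \<beta>_def ge gf)
  have \<beta>: "\<beta> r = \<alpha> r" for r using gh_eq[of r 1] gh_eq[of 1 r] by (simp add: one)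
  have mult: "\<alpha> (r * s) = \<alpha> r * \<alpha> s" for r s
    using gh_eq[of r s] gh_eq[of "r * s" 1] by (simp add: one \<beta>)
  have add: "\<alpha> (r + s) = \<alpha> r + \<alpha> s" for r s
    using g_add[of "mat2 0 r 0 0" "mat2 0 s 0 0"] by (simp add: ge_eq)
  have scl: "\<alpha> (scl k r) = scl k (\<alpha> r)" for k r
    using g_scl[of "mat2 0 r 0 0" k] by (simp add: ge_eq)
  have g_eq: "g (mat2 a b c (- a)) = mat2 (\<alpha> a) (\<alpha> b) (\<alpha> c) (- \<alpha> a)" for a b c
  proof -
    have "mat2 a b c (- a) = mat2 a 0 0 (- a) + (mat2 0 b 0 0 + mat2 0 0 c 0)" by simp
    also have "g \<dots> = g (mat2 a 0 0 (- a)) + (g (mat2 0 b 0 0) + g (mat2 0 0 c 0))"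
      by (subst g_add) (simp_all add: g_add[symmetric])
    finally show ?thesis using gh_eq[of a 1] by (simp add: ge_eq gf_eq \<beta> one)
  qed
  have "inj \<alpha>"
  proof (rule injI)
    fix r s assume "\<alpha> r = \<alpha> s"
    then have "g (mat2 0 r 0 0) = g (mat2 0 s 0 0)" by (simp add: ge_eq)
    then have "mat2 0 r 0 0 = mat2 0 s 0 0"
      by (rule inj_onD[OF bij_betw_imp_inj_on[OF Aut_sl2D(2)[OF g]]]) simp_all
    then show "r = s" by simp
  qed
  moreover have "surj \<alpha>"
  unfolding surj_def
  proof
    fix s
    have "mat2 0 s 0 0 \<in> g ` sl2" using Aut_sl2D(2)[OF g] by (simp add: bij_betw_def)
    then obtain X where "X \<in> sl2" "mat2 0 s 0 0 = g X" by blast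
    then show "\<exists>r. s = \<alpha> r" by (metis g_eq mat2_eq_iff sl2_cases)
  qed
  ultimately have "\<alpha> \<in> carrier (Aut_alg scl)"
    by (simp add: Aut_alg_iff bij_def one add mult scl)
  moreover have "g = entrywise \<alpha>"
  proof (rule extensionalityI[where A = sl2])
    interpret additive \<alpha> by unfold_locales (rule add)
    fix X :: "'r ^ 2 ^ 2" assume "X \<in> sl2"
    then show "g X = entrywise \<alpha> X"
      by (cases rule: sl2_cases) (simp add: g_eq entrywise_def minus)
  qed (use Aut_sl2D(1)[OF g] in \<open>auto simp: entrywise_def\<close>)
  ultimately show ?thesis by (rule that)
qed

section \<open>The semidirect decomposition\<close>

lemma two_neq_zero_if_CHAR:
  fixes scl :: "'f::field \<Rightarrow> 'r::ufd \<Rightarrow> 'r"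
  assumes "CHAR('f) \<noteq> 2" and "comm_algebra scl"
  shows "(2::'r) \<noteq> 0"
proof
  interpret comm_algebra scl by fact
  assume "(2::'r) = 0"
  moreover have "scl 2 1 = 2" using scale_left_distrib[of 1 1 1] by simp
  ultimately have "(of_nat 2 :: 'f) = 0" using scale_eq_0_iff[of 2 1] by simp
  then have "CHAR('f) dvd 2" by (simp only: of_nat_eq_0_iff_char_dvd)
  moreover have "CHAR('f) \<noteq> 1" by simp
  ultimately show False using assms(1) by (metis prime_nat_iff two_is_prime_nat)
qed

lemma Aut_sl2_decomposition:
  fixes scl :: "'f::field \<Rightarrow> 'r::ufd \<Rightarrow> 'r"
  assumes "CHAR('f) \<noteq> 2" and alg: "comm_algebra scl" and g: "g \<in> carrier (Aut_sl2 scl)"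
  obtains P \<rho> where "P \<in> carrier GL2" "\<rho> \<in> carrier (Aut_alg scl)"
    "g = conj_by P \<otimes>\<^bsub>Aut_sl2 scl\<^esub> entrywise \<rho>"
proof -
  interpret comm_algebra scl by fact
  interpret A: group "Aut_sl2 scl" by (rule group_Aut_sl2)
  have two: "(2::'r) \<noteq> 0" using two_neq_zero_if_CHAR assms(1,2) .
  let ?e = "mat2 0 1 0 0 :: 'r ^ 2 ^ 2" and ?f = "mat2 0 0 1 0 :: 'r ^ 2 ^ 2"
  have sl2: "?e \<in> sl2" "?f \<in> sl2" by simp_all
  have brE: "lie_bracket (lie_bracket (g ?e) (g ?f)) (g ?e) = g ?e + g ?e"
  proof -
    have "lie_bracket (lie_bracket ?e ?f) ?e = ?e + ?e" by (simp add: lie_bracket_def)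
    then show ?thesis by (metis Aut_sl2D(4,6)[OF g] sl2 sl2_lie_bracket)
  qed
  have brF: "lie_bracket (lie_bracket (g ?f) (g ?e)) (g ?f) = g ?f + g ?f"
  proof -
    have "lie_bracket (lie_bracket ?f ?e) ?f = ?f + ?f" by (simp add: lie_bracket_def)
    then show ?thesis by (metis Aut_sl2D(4,6)[OF g] sl2 sl2_lie_bracket)
  qed
  have zero: "(0 :: 'r ^ 2 ^ 2) \<in> sl2" by (simp add: sl2_def)
  have "g 0 = 0" using Aut_sl2D(4)[OF g zero zero] by simp
  moreover have "?e \<noteq> 0" by (simp add: vec_eq_iff forall_2)
  ultimately have "g ?e \<noteq> 0"
    using inj_onD[OF bij_betw_imp_inj_on[OF Aut_sl2D(2)[OF g]], of ?e 0] sl2 zero by auto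
  then obtain P where P: "det P dvd 1" and "P ** ?e = g ?e ** P" "P ** ?f = g ?f ** P"
    using sl2_triple_conjugate[OF two _ _ _ brE brF] Aut_sl2D(3)[OF g] sl2 by blast
  then have ef: "conj_by P ?e = g ?e" "conj_by P ?f = g ?f"
    using conj_by_eq_iff[OF P] sl2 by blast+
  define k where "k = conj_by (matrix_inv P) \<otimes>\<^bsub>Aut_sl2 scl\<^esub> g"
  have Q: "det (matrix_inv P) dvd 1" by (rule det_matrix_inv_unit[OF P])
  have k: "k \<in> carrier (Aut_sl2 scl)" unfolding k_def using conj_by_in_Aut_sl2[OF Q] g by simp
  have k_eq: "k X = conj_by (matrix_inv P) (g X)" if "X \<in> sl2" for X
    using that by (simp add: k_def Aut_sl2_mult conj_by_in_Aut_sl2 Q g)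
  have "k ?e = ?e" "k ?f = ?f"
    using conj_by_inverse(1)[OF P] sl2 by (simp_all add: k_eq flip: ef)
  moreover have "x = 0" if "x + x = 0" for x :: 'r
    using that two by (metis mult_2 mult_eq_0_iff)
  ultimately obtain \<rho> where \<rho>: "\<rho> \<in> carrier (Aut_alg scl)" "k = entrywise \<rho>"
    using Aut_sl2_fixing_triple[OF _ k] by blast
  have "g = conj_by P \<otimes>\<^bsub>Aut_sl2 scl\<^esub> k"
  proof (rule extensionalityI[where A = sl2])
    fix X :: "'r ^ 2 ^ 2" assume X: "X \<in> sl2"
    then show "g X = (conj_by P \<otimes>\<^bsub>Aut_sl2 scl\<^esub> k) X"
      using P k Aut_sl2D(3)[OF g X]
      by (simp add: Aut_sl2_mult conj_by_in_Aut_sl2 k_eq conj_by_inverse)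
  qed (use P k Aut_sl2D(1)[OF g] in \<open>auto simp: Aut_sl2_mult conj_by_in_Aut_sl2\<close>)
  then show ?thesis using that[of P \<rho>] P \<rho> by simp
qed

theorem theorem5:
  fixes scl :: "'f::field \<Rightarrow> 'r::ufd \<Rightarrow> 'r"
  assumes "CHAR('f) \<noteq> 2"
    and "comm_algebra scl"
  shows "PGL2_action \<in> mon PGL2 (Aut_sl2 scl)
    \<and> entrywise \<in> mon (Aut_alg scl) (Aut_sl2 scl)
    \<and> internal_semidirect_product (Aut_sl2 scl)
        (PGL2_action ` carrier PGL2) (entrywise ` carrier (Aut_alg scl))"
proof -
  interpret comm_algebra scl by fact
  interpret A: group "Aut_sl2 scl" by (rule group_Aut_sl2)
  interpret C: group_hom GL2 "Aut_sl2 scl" conj_by by (rule group_hom_conj_by)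
  interpret D: group_hom "Aut_alg scl" "Aut_sl2 scl" entrywise by (rule group_hom_entrywise)
  let ?A = "Aut_sl2 scl" and ?N = "conj_by ` carrier GL2 :: ('r ^ 2 ^ 2 \<Rightarrow> 'r ^ 2 ^ 2) set"
    and ?H = "entrywise ` carrier (Aut_alg scl)"
  have N: "subgroup ?N ?A" by (rule C.img_is_subgroup)
  have H: "subgroup ?H ?A" by (rule D.img_is_subgroup)
  have NH: "?N <#>\<^bsub>?A\<^esub> ?H = carrier ?A"
  proof
    show "?N <#>\<^bsub>?A\<^esub> ?H \<subseteq> carrier ?A"
      using subgroup.subset[OF N] subgroup.subset[OF H] by (rule A.set_mult_closed)
    show "carrier ?A \<subseteq> ?N <#>\<^bsub>?A\<^esub> ?H"
      by (auto simp: set_mult_def elim!: Aut_sl2_decomposition[OF assms])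
  qed
  have swap: "entrywise \<rho> \<otimes>\<^bsub>?A\<^esub> conj_by Q = conj_by (map_matrix \<rho> Q) \<otimes>\<^bsub>?A\<^esub> entrywise \<rho>"
    "det (map_matrix \<rho> Q) dvd 1"
    if \<rho>: "\<rho> \<in> carrier (Aut_alg scl)" and Q: "det Q dvd 1" for \<rho> Q
  proof -
    show det: "det (map_matrix \<rho> Q) dvd 1"
      using \<rho> Q by (rule det_map_matrix_Aut_alg_unit)
    show "entrywise \<rho> \<otimes>\<^bsub>?A\<^esub> conj_by Q = conj_by (map_matrix \<rho> Q) \<otimes>\<^bsub>?A\<^esub> entrywise \<rho>"
      by (simp add: Aut_sl2_mult entrywise_in_Aut_sl2 conj_by_in_Aut_sl2 \<rho> Q det
          entrywise_conj_by cong: restrict_cong)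
  qed
  have "?N \<lhd> ?A"
  proof (rule A.normal_invI[OF N])
    fix g n assume g: "g \<in> carrier ?A" and "n \<in> ?N"
    then obtain Q where Q: "det Q dvd 1" "n = conj_by Q" by auto
    obtain P \<rho> where P: "P \<in> carrier GL2" and \<rho>: "\<rho> \<in> carrier (Aut_alg scl)"
      and g_eq: "g = conj_by P \<otimes>\<^bsub>?A\<^esub> entrywise \<rho>"
      using Aut_sl2_decomposition[OF assms g] by blast
    define c d r where "c = conj_by P" and "d = conj_by (map_matrix \<rho> Q)" and "r = entrywise \<rho>"
    have mem: "c \<in> ?N" "d \<in> ?N" "c \<in> carrier ?A" "d \<in> carrier ?A" "r \<in> carrier ?A" "n \<in> carrier ?A"
      using P Q \<rho> swap(2)[OF \<rho> Q(1)]
      by (auto simp: c_def d_def r_def conj_by_in_Aut_sl2 entrywise_in_Aut_sl2)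
    have "r \<otimes>\<^bsub>?A\<^esub> n = d \<otimes>\<^bsub>?A\<^esub> r" using swap(1)[OF \<rho> Q(1)] by (simp add: r_def d_def Q(2))
    then have "r \<otimes>\<^bsub>?A\<^esub> n \<otimes>\<^bsub>?A\<^esub> inv\<^bsub>?A\<^esub> r = d"
      using mem by (simp add: A.m_assoc)
    moreover have "g \<otimes>\<^bsub>?A\<^esub> n \<otimes>\<^bsub>?A\<^esub> inv\<^bsub>?A\<^esub> g
      = c \<otimes>\<^bsub>?A\<^esub> (r \<otimes>\<^bsub>?A\<^esub> n \<otimes>\<^bsub>?A\<^esub> inv\<^bsub>?A\<^esub> r) \<otimes>\<^bsub>?A\<^esub> inv\<^bsub>?A\<^esub> c"
      using mem(3-) g_eq[folded c_def r_def] by (simp add: A.inv_mult_group A.m_assoc)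
    ultimately show "g \<otimes>\<^bsub>?A\<^esub> n \<otimes>\<^bsub>?A\<^esub> inv\<^bsub>?A\<^esub> g \<in> ?N"
      using mem(1,2) N by (simp add: subgroup.m_closed subgroup.m_inv_closed)
  qed
  moreover have "?N \<inter> ?H = {\<one>\<^bsub>?A\<^esub>}"
  proof
    show "{\<one>\<^bsub>?A\<^esub>} \<subseteq> ?N \<inter> ?H" using N H by (simp add: subgroup.one_closed)
    show "?N \<inter> ?H \<subseteq> {\<one>\<^bsub>?A\<^esub>}"
    proof
      fix f assume "f \<in> ?N \<inter> ?H"
      then obtain P \<rho> where P: "det P dvd 1" and f: "f = conj_by P" "f = entrywise \<rho>"
        and \<rho>: "\<rho> \<in> carrier (Aut_alg scl)" by auto
      \<comment> \<open>Being both \<open>R\<close>-linear and entrywise, \<open>f\<close> sends \<open>x e\<close> to \<open>x e\<close> and to \<open>\<rho> x e\<close>.\<close>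
      have "\<rho> x = x" for x
      proof -
        let ?e = "mat2 0 1 0 0 :: 'r ^ 2 ^ 2"
        have e: "conj_by P ?e = ?e"
          by (simp add: f(1)[symmetric] f(2) entrywise_def Aut_alg_simps[OF \<rho>])
        have "P ** ?e = ?e ** P" using e conj_by_eq_iff[OF P, of ?e ?e] by simp
        then have "P ** (mat x ** ?e) = (mat x ** ?e) ** P"
          by (metis mat_mult_commute matrix_mul_assoc)
        then have "conj_by P (mat2 0 x 0 0) = mat2 0 x 0 0"
          by (simp add: conj_by_eq_iff P) (simp add: mat_eq_mat2)
        then show ?thesis by (simp add: f(1)[symmetric] f(2) entrywise_def)
      qed
      then have "f = (\<lambda>X\<in>sl2. X)"
        by (auto simp: f(2) entrywise_def vec_eq_iff intro!: restrict_ext)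
      then show "f \<in> {\<one>\<^bsub>?A\<^esub>}" by (simp add: Aut_sl2_one)
    qed
  qed
  ultimately have "internal_semidirect_product ?A ?N ?H"
    using H NH by (simp add: internal_semidirect_product_def)
  then show ?thesis
    using PGL2_action_mon entrywise_inj D.homh by (simp add: PGL2_action_image mon_def)
qed

end
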